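(* Let $a_1=\frac{40+3\sqrt{205}}{105}\approx 0.79003$ and let $F_{a_1}(x)=\psi(x+1)-\mathcal{L}(x,a_1)$ for $x\in(-1,\infty)$. Then for every $x>-1$ and every $n\in\{1,2,3\}$, $$(-1)^n F_{a_1}^{(n)}(x)<0,$$ where $F_{a_1}^{(n)}$ denotes the $n$-th derivative of $F_{a_1}$.
   Context: $\psi(x)=\Gamma'(x)/\Gamma(x)$ ($x>0$) is the digamma (psi) function. The function $\mathcal{L}(x,a)$ is defined for $(x,a)\in(-1,\infty)\times(4/15,\infty)$ or $(x,a)\in(0,\infty)\times(1/15,\infty)$ by $$\mathcal{L}(x,a)=\frac{1}{90a^{2}+2}\ln\left(x^{2}+x+\frac{3a+1}{3}\right)+\frac{45a^{2}}{90a^{2}+2}\ln\left(x^{2}+x+\frac{15a-1}{45a}\right).$$ *)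

theory Defs
  imports "HOL-Analysis.Analysis"
begin

text \<open>
  The intended domain is that of pairs with \<open>x > -1\<close>, \<open>a > 4/15\<close> or \<open>x > 0\<close>, \<open>a > 1/15\<close>, on which
  both arguments of the logarithm are positive.
\<close>

definition \<L> :: "real \<Rightarrow> real \<Rightarrow> real" where
  "\<L> x a = 1 / (90 * a\<^sup>2 + 2) * ln (x\<^sup>2 + x + (3 * a + 1) / 3)
         + 45 * a\<^sup>2 / (90 * a\<^sup>2 + 2) * ln (x\<^sup>2 + x + (15 * a - 1) / (45 * a))"

definition a1 :: real where
  "a1 = (40 + 3 * sqrt 205) / 105"

text \<open>
  The library's \<open>Digamma\<close> is the logarithmic derivative of \<open>Gamma\<close>; see
  \<open>has_field_derivative_Gamma\<close>.  \<open>F\<close> is meant on \<open>x > -1\<close>: since that is an open set, the iterated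
  \<open>deriv\<close> at such a point depends only on the values of \<open>F\<close> there.
\<close>

definition F :: "real \<Rightarrow> real \<Rightarrow> real" where
  "F a x = Digamma (x + 1) - \<L> x a"

end

theory Submission
  imports Defs "HOL-Real_Asymp.Real_Asymp"
begin

text \<open>
  Since \<open>Digamma (u + 1) - Digamma u = 1 / u\<close>, the unit difference \<open>F a1 u - F a1 (u - 1)\<close> is
  elementary, and its derivative is a rational function of \<open>w = u\<^sup>2\<close>. Over a denominator of degree
  five in \<open>w\<close> its numerator has formal degree four. For every parameter \<open>a\<close> the coefficients of
  \<open>w ^ 4\<close>, \<open>w ^ 3\<close> and \<open>w\<^sup>2\<close> vanish, because \<open>\<L>\<close> matches the beginning of the asymptotic expansion of
  the digamma function; \<open>a1\<close> is the parameter for which that of \<open>w\<close> vanishes as well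
  (\<open>numerator_collapses\<close>). What remains is \<open>- 144 / E u\<close> (\<open>diff_F1\<close>) with an even polynomial \<open>E\<close> that
  has rational coefficients and is positive for \<open>u > 0\<close>.

  All three signs follow from the convexity of \<open>1 / E\<close> on the positive half-line. Differentiating
  the identity twice, this convexity says that the third derivative \<open>F3\<close> of \<open>F a1\<close> strictly decreases
  along unit steps; since it tends to \<open>0\<close>, it is positive (\<open>pos_if_unit_steps_decrease\<close>). Hence the
  second derivative is strictly increasing with limit \<open>0\<close>, so it is negative, and therefore the first
  derivative is strictly decreasing with limit \<open>0\<close>, so it is positive (\<open>pos_if_deriv_neg\<close>).

  Convexity of \<open>1 / E\<close> means \<open>2 E'\<^sup>2 - E E'' > 0\<close>, a polynomial inequality which, after division by
  \<open>w\<close>, has degree eight in \<open>w\<close>; \<open>convexity_polynomial_pos\<close> settles it by a sum-of-squares certificate.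
\<close>

section \<open>Functions vanishing along unit translates\<close>

text \<open>
  The values \<open>G (x + m)\<close> decrease strictly in \<open>m\<close> to their limit \<open>0\<close>, so the first one exceeds it.
\<close>

lemma pos_if_unit_steps_decrease:
  fixes G :: "real \<Rightarrow> real"
  assumes step: "\<And>y. y \<ge> x \<Longrightarrow> G (y + 1) < G y"
    and lim: "(\<lambda>m. G (x + real m)) \<longlonglongrightarrow> 0"
  shows "G x > 0"
proof -
  have dec: "decseq (\<lambda>m. G (x + 1 + real m))"
  proof (rule decseq_SucI)
    fix m show "G (x + 1 + real (Suc m)) \<le> G (x + 1 + real m)"
      using step[of "x + 1 + real m"] by (simp add: algebra_simps)
  qed
  have "(\<lambda>m. G (x + 1 + real m)) \<longlonglongrightarrow> 0"
    using LIMSEQ_Suc[OF lim] by (simp add: add_ac)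
  from decseq_ge[OF dec this, of 0] have "0 \<le> G (x + 1)" by simp
  then show ?thesis using step[of x] by simp
qed

lemma pos_if_deriv_neg:
  fixes G G' :: "real \<Rightarrow> real"
  assumes der: "\<And>y. y \<ge> x \<Longrightarrow> (G has_real_derivative G' y) (at y)"
    and neg: "\<And>y. y \<ge> x \<Longrightarrow> G' y < 0"
    and lim: "(\<lambda>m. G (x + real m)) \<longlonglongrightarrow> 0"
  shows "G x > 0"
proof (rule pos_if_unit_steps_decrease[OF _ lim])
  fix y assume "y \<ge> x"
  then show "G (y + 1) < G y"
    using der neg by (intro DERIV_neg_imp_decreasing[of y "y + 1" G]) (meson order_trans less_add_one)+
qed

text \<open>
  For \<open>n \<ge> 1\<close> the polygamma function is a convergent series over the translates of its argument, so
  shifting the argument by \<open>m\<close> leaves a tail of that series.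
\<close>

lemma Polygamma_shift_tendsto_0:
  fixes x :: real
  assumes "x > 0" and "n > 0"
  shows "(\<lambda>m. Polygamma n (x + real m)) \<longlonglongrightarrow> 0"
proof -
  define f where "f k = inverse ((x + real k) ^ Suc n)" for k
  have summ: "summable f"
    unfolding f_def using Polygamma_LIMSEQ[of x n] assms by (auto simp: sums_iff)
  have "(\<lambda>m. (\<Sum>k. f (k + m))) = (\<lambda>m. suminf f - sum f {..<m})"
    using suminf_split_initial_segment[OF summ] by (auto simp: fun_eq_iff algebra_simps)
  moreover have "(\<lambda>m. suminf f - sum f {..<m}) \<longlonglongrightarrow> suminf f - suminf f"
    by (intro tendsto_intros summable_LIMSEQ summ)
  ultimately have tail: "(\<lambda>m. (\<Sum>k. f (k + m))) \<longlonglongrightarrow> 0" by simp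
  have eq: "Polygamma n (x + real m) = (-1) ^ Suc n * fact n * (\<Sum>k. f (k + m))" for m
    using assms(2) by (simp add: Polygamma_def f_def add_ac)
  show ?thesis unfolding eq by (rule tendsto_mult_right_zero[OF tail])
qed

section \<open>Derivatives of the logarithms of quadratics\<close>

definition lnq1 :: "real \<Rightarrow> real \<Rightarrow> real" where
  "lnq1 c x = (2 * x + 1) / (x\<^sup>2 + x + c)"

definition lnq2 :: "real \<Rightarrow> real \<Rightarrow> real" where
  "lnq2 c x = 2 / (x\<^sup>2 + x + c) - (2 * x + 1)\<^sup>2 / (x\<^sup>2 + x + c)\<^sup>2"

definition lnq3 :: "real \<Rightarrow> real \<Rightarrow> real" where
  "lnq3 c x = 2 * (2 * x + 1) ^ 3 / (x\<^sup>2 + x + c) ^ 3 - 6 * (2 * x + 1) / (x\<^sup>2 + x + c)\<^sup>2"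

lemma quadratic_pos:
  fixes x c :: real
  assumes "c > 1/4"
  shows "x\<^sup>2 + x + c > 0"
proof -
  have "x\<^sup>2 + x + c = (x + 1/2)\<^sup>2 + (c - 1/4)" by (simp add: power2_eq_square algebra_simps)
  then show ?thesis using assms zero_le_power2[of "x + 1/2"] by linarith
qed

lemma has_derivative_quadratic:
  "((\<lambda>x. x\<^sup>2 + x + c) has_real_derivative 2 * x + 1) (at x)"
  by (auto intro!: derivative_eq_intros)

lemma has_derivative_ln_quadratic:
  assumes "c > 1/4"
  shows "((\<lambda>x. ln (x\<^sup>2 + x + c)) has_real_derivative lnq1 c x) (at x)"
  unfolding lnq1_def
  by (rule derivative_eq_intros refl quadratic_pos[OF assms] | simp)+

lemma has_derivative_lnq1:
  assumes "c > 1/4"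
  shows "(lnq1 c has_real_derivative lnq2 c x) (at x)"
proof -
  have q: "x\<^sup>2 + x + c \<noteq> 0" using quadratic_pos[OF assms, of x] by simp
  have t: "((\<lambda>x. 2 * x + 1) has_real_derivative 2) (at x)"
    by (auto intro!: derivative_eq_intros)
  have "(2 * q - t * t) / (q * q) = 2 / q - t\<^sup>2 / q\<^sup>2" if "q \<noteq> 0" for q t :: real
    using that by (simp add: field_simps power2_eq_square)
  from DERIV_divide[OF t has_derivative_quadratic q, unfolded this[OF q]]
  show ?thesis unfolding lnq1_def[abs_def] lnq2_def .
qed

lemma has_derivative_lnq2:
  assumes "c > 1/4"
  shows "(lnq2 c has_real_derivative lnq3 c x) (at x)"
proof -
  define q where "q = (\<lambda>x. x\<^sup>2 + x + c)"
  have q: "q x \<noteq> 0" using quadratic_pos[OF assms, of x] by (simp add: q_def)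
  have dq: "(q has_real_derivative 2 * x + 1) (at x)"
    unfolding q_def by (rule has_derivative_quadratic)
  have dq2: "((\<lambda>x. (q x)\<^sup>2) has_real_derivative 2 * q x * (2 * x + 1)) (at x)"
    by (auto intro!: derivative_eq_intros dq)
  have dt2: "((\<lambda>x. (2 * x + 1)\<^sup>2) has_real_derivative 4 * (2 * x + 1)) (at x)"
    by (auto intro!: derivative_eq_intros)
  have q2: "(q x)\<^sup>2 \<noteq> 0" using q by simp
  have "(0 * q - 2 * t) / (q * q) - (4 * t * q\<^sup>2 - t\<^sup>2 * (2 * q * t)) / (q\<^sup>2 * q\<^sup>2)
      = 2 * t ^ 3 / q ^ 3 - 6 * t / q\<^sup>2" if "q \<noteq> 0" for q t :: real
    using that by (simp add: field_simps power2_eq_square power3_eq_cube)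
  from DERIV_diff[OF DERIV_divide[OF DERIV_const dq q] DERIV_divide[OF dt2 dq2 q2],
      of 2, unfolded this[OF q]]
  show ?thesis unfolding lnq2_def[abs_def] lnq3_def q_def .
qed

lemma lnq_tendsto_0:
  "(lnq1 c \<longlongrightarrow> 0) at_top" "(lnq2 c \<longlongrightarrow> 0) at_top" "(lnq3 c \<longlongrightarrow> 0) at_top"
  unfolding lnq1_def[abs_def] lnq2_def[abs_def] lnq3_def[abs_def] by real_asymp+

section \<open>The constants belonging to the optimal parameter\<close>

definition c1 :: real where "c1 = 5/7 + sqrt 205 / 35"
definition d1 :: real where "d1 = 5/7 - sqrt 205 / 35"
definition A1 :: real where "A1 = 1/4 - 2 * sqrt 205 / 123"
definition B1 :: real where "B1 = 1/4 + 2 * sqrt 205 / 123"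

lemma \<L>_a1: "\<L> x a1 = A1 * ln (x\<^sup>2 + x + c1) + B1 * ln (x\<^sup>2 + x + d1)"
proof -
  define s where "s = sqrt (205 :: real)"
  have ss: "s * s = 205" and s0: "s > 0" by (simp_all add: s_def)
  have sq: "a1\<^sup>2 = (3445 + 240 * s) / 11025"
    using ss by (simp add: a1_def s_def[symmetric] power2_eq_square field_simps)
  have A: "1 / (90 * a1\<^sup>2 + 2) = A1"
    using ss s0 unfolding sq A1_def s_def[symmetric] by (simp add: field_simps)
  have B: "45 * a1\<^sup>2 / (90 * a1\<^sup>2 + 2) = B1"
    using ss s0 unfolding sq B1_def s_def[symmetric] by (simp add: field_simps)
  have c: "(3 * a1 + 1) / 3 = c1"
    by (simp add: a1_def c1_def field_simps)
  have d: "(15 * a1 - 1) / (45 * a1) = d1"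
    using ss s0 unfolding a1_def d1_def s_def[symmetric] by (simp add: field_simps)
  show ?thesis unfolding \<L>_def A B c d ..
qed

lemma c1_gt: "c1 > 1/4" and d1_gt: "d1 > 1/4"
proof -
  have "sqrt 205 < sqrt (15 ^ 2 :: real)" by (subst real_sqrt_less_iff) simp
  then have "sqrt 205 < (15 :: real)" by simp
  then show "d1 > 1/4" by (simp add: d1_def)
  show "c1 > 1/4" unfolding c1_def by (rule less_le_trans[of _ "5/7"]) auto
qed

text \<open>
  The first two relations hold for the weights and constant terms belonging to any parameter \<open>a\<close>. The
  values of \<open>c1 + d1\<close> and \<open>c1 * d1\<close> depend on \<open>a\<close>; both are rational at \<open>a1\<close> because there \<open>c1\<close> and \<open>d1\<close>
  are conjugate in the field generated by \<open>sqrt 205\<close>.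
\<close>

lemma constants_relations:
  "A1 + B1 = 1/2" "A1 * c1 + B1 * d1 = 1/6" "c1 + d1 = 10/7" "c1 * d1 = 12/35"
  by (simp_all add: A1_def B1_def c1_def d1_def algebra_simps)

section \<open>The derivatives of the approximation error\<close>

definition F1 :: "real \<Rightarrow> real" where
  "F1 x = Polygamma 1 (x + 1) - (A1 * lnq1 c1 x + B1 * lnq1 d1 x)"

definition F2 :: "real \<Rightarrow> real" where
  "F2 x = Polygamma 2 (x + 1) - (A1 * lnq2 c1 x + B1 * lnq2 d1 x)"

definition F3 :: "real \<Rightarrow> real" where
  "F3 x = Polygamma 3 (x + 1) - (A1 * lnq3 c1 x + B1 * lnq3 d1 x)"

lemma has_derivative_Polygamma_Suc_arg:
  fixes x :: real
  assumes "x > -1"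
  shows "((\<lambda>x. Polygamma n (x + 1)) has_real_derivative Polygamma (Suc n) (x + 1)) (at x)"
proof -
  have "x + 1 \<notin> \<int>\<^sub>\<le>\<^sub>0" using assms by (auto elim!: nonpos_Ints_cases)
  then show ?thesis by (auto intro!: derivative_eq_intros)
qed

lemma has_derivative_F:
  assumes "x > -1"
  shows "(F a1 has_real_derivative F1 x) (at x)"
  unfolding F_def[abs_def] \<L>_a1 F1_def One_nat_def
  by (intro DERIV_diff DERIV_add DERIV_cmult has_derivative_Polygamma_Suc_arg assms
      has_derivative_ln_quadratic c1_gt d1_gt)

lemma has_derivative_F1:
  assumes "x > -1"
  shows "(F1 has_real_derivative F2 x) (at x)"
  using has_derivative_Polygamma_Suc_arg[OF assms, of 1]
  unfolding F1_def[abs_def] F2_def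
  by (intro DERIV_diff DERIV_add DERIV_cmult has_derivative_lnq1 c1_gt d1_gt)
    (simp add: numeral_2_eq_2)

lemma has_derivative_F2:
  assumes "x > -1"
  shows "(F2 has_real_derivative F3 x) (at x)"
  using has_derivative_Polygamma_Suc_arg[OF assms, of 2]
  unfolding F2_def[abs_def] F3_def
  by (intro DERIV_diff DERIV_add DERIV_cmult has_derivative_lnq2 c1_gt d1_gt)
    (simp add: numeral_3_eq_3 numeral_2_eq_2)

lemma F123_shift_tendsto_0:
  assumes "x > -1"
  shows "(\<lambda>m. F1 (x + real m)) \<longlonglongrightarrow> 0" "(\<lambda>m. F2 (x + real m)) \<longlonglongrightarrow> 0"
    "(\<lambda>m. F3 (x + real m)) \<longlonglongrightarrow> 0"
proof -
  have shift: "filterlim (\<lambda>m. x + real m) at_top sequentially" by real_asymp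
  have *: "(\<lambda>m. Polygamma n (x + real m + 1) - (A1 * f c1 (x + real m) + B1 * f d1 (x + real m)))
      \<longlonglongrightarrow> 0" if "n > 0" and f: "\<And>c. (f c \<longlongrightarrow> 0) at_top" for n and f :: "real \<Rightarrow> real \<Rightarrow> real"
  proof -
    have "(\<lambda>m. Polygamma n (x + real m + 1)) \<longlonglongrightarrow> 0"
      using Polygamma_shift_tendsto_0[of "x + 1" n] assms that(1) by (simp add: add_ac)
    moreover have "(\<lambda>m. f c (x + real m)) \<longlonglongrightarrow> 0" for c
      using filterlim_compose[OF f shift] .
    ultimately have "(\<lambda>m. Polygamma n (x + real m + 1) -
        (A1 * f c1 (x + real m) + B1 * f d1 (x + real m))) \<longlonglongrightarrow> 0 - (A1 * 0 + B1 * 0)"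
      by (intro tendsto_intros)
    then show ?thesis by simp
  qed
  show "(\<lambda>m. F1 (x + real m)) \<longlonglongrightarrow> 0" "(\<lambda>m. F2 (x + real m)) \<longlonglongrightarrow> 0"
    "(\<lambda>m. F3 (x + real m)) \<longlonglongrightarrow> 0"
    unfolding F1_def F2_def F3_def by (rule *; simp add: lnq_tendsto_0)+
qed

section \<open>The unit difference of the first derivative\<close>

definition E :: "real \<Rightarrow> real" where
  "E u = 1225 * u ^ 10 + 1050 * u ^ 8 + 1065 * u ^ 6 - 460 * u ^ 4 + 144 * u\<^sup>2"

definition E' :: "real \<Rightarrow> real" where
  "E' u = 12250 * u ^ 9 + 8400 * u ^ 7 + 6390 * u ^ 5 - 1840 * u ^ 3 + 288 * u"

definition E'' :: "real \<Rightarrow> real" where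
  "E'' u = 110250 * u ^ 8 + 58800 * u ^ 6 + 31950 * u ^ 4 - 5520 * u\<^sup>2 + 288"

lemma has_derivative_E: "(E has_real_derivative E' u) (at u)"
  unfolding E_def[abs_def] E'_def by (auto intro!: derivative_eq_intros)

lemma has_derivative_E': "(E' has_real_derivative E'' u) (at u)"
  unfolding E'_def[abs_def] E''_def by (auto intro!: derivative_eq_intros)

lemma quadratic_pair_product:
  fixes u c :: real
  shows "(u\<^sup>2 + u + c) * ((u - 1)\<^sup>2 + (u - 1) + c) = (u\<^sup>2 + c)\<^sup>2 - u\<^sup>2"
  by (simp add: power2_eq_square algebra_simps)

text \<open>
  The product is symmetric in \<open>c1\<close> and \<open>d1\<close>, hence a polynomial in \<open>w\<close>, \<open>c1 + d1\<close> and \<open>c1 * d1\<close>; this is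
  why the irrationalities disappear.
\<close>

lemma quadratic_product:
  "((w + c1)\<^sup>2 - w) * ((w + d1)\<^sup>2 - w)
    = w ^ 4 + 6/7 * w ^ 3 + 213/245 * w\<^sup>2 - 92/245 * w + 144/1225"
proof -
  have "((w + c1)\<^sup>2 - w) * ((w + d1)\<^sup>2 - w)
      = (w\<^sup>2 + (c1 + d1) * w + c1 * d1)\<^sup>2
        - w * ((2 * w + (c1 + d1))\<^sup>2 - 2 * (w\<^sup>2 + (c1 + d1) * w + c1 * d1)) + w\<^sup>2"
    by (simp add: power2_eq_square algebra_simps)
  then show ?thesis
    unfolding constants_relations
    by (simp add: power2_eq_square eval_nat_numeral algebra_simps)
qed

lemma E_factor:
  "E u = 1225 * u\<^sup>2 * (((u\<^sup>2 + c1)\<^sup>2 - u\<^sup>2) * ((u\<^sup>2 + d1)\<^sup>2 - u\<^sup>2))"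
  unfolding quadratic_product E_def by (simp add: eval_nat_numeral algebra_simps)

lemma quadratic_pair_pos:
  fixes u c :: real
  assumes "c > 1/4"
  shows "(u\<^sup>2 + c)\<^sup>2 - u\<^sup>2 > 0"
  using quadratic_pos[OF assms, of u] quadratic_pos[OF assms, of "u - 1"]
  by (metis quadratic_pair_product mult_pos_pos)

lemma E_pos:
  assumes "u > 0"
  shows "E u > 0"
  unfolding E_factor using assms quadratic_pair_pos[OF c1_gt] quadratic_pair_pos[OF d1_gt]
  by (intro mult_pos_pos) auto

lemma lnq1_diff:
  assumes "c > 1/4"
  shows "lnq1 c u - lnq1 c (u - 1) = - 2 * (u\<^sup>2 - c) / ((u\<^sup>2 + c)\<^sup>2 - u\<^sup>2)"
proof -
  have *: "u\<^sup>2 + u + c \<noteq> 0" "(u - 1)\<^sup>2 + (u - 1) + c \<noteq> 0"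
    using quadratic_pos[OF assms, of u] quadratic_pos[OF assms, of "u - 1"] by simp_all
  have "(2 * u + 1) * ((u - 1)\<^sup>2 + (u - 1) + c) - (2 * (u - 1) + 1) * (u\<^sup>2 + u + c)
      = - 2 * (u\<^sup>2 - c)"
    by (simp add: power2_eq_square algebra_simps)
  then show ?thesis
    unfolding lnq1_def diff_frac_eq[OF *] quadratic_pair_product by (simp add: mult.commute)
qed

text \<open>
  The numerator over the common denominator is a quartic polynomial in \<open>w\<close>. Its coefficients are
  invariant under exchanging \<open>(A1, c1)\<close> with \<open>(B1, d1)\<close>, hence polynomials in \<open>c1 + d1\<close>, \<open>c1 * d1\<close>,
  \<open>A1 + B1\<close> and \<open>A1 * c1 + B1 * d1\<close>, so that the known values of these determine them.
\<close>

lemma numerator_collapses: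
  fixes w :: real
  shows "((w + c1)\<^sup>2 - w) * ((w + d1)\<^sup>2 - w)
      - 2 * w * (A1 * (w - c1) * ((w + d1)\<^sup>2 - w) + B1 * (w - d1) * ((w + c1)\<^sup>2 - w))
      = 144 / 1225"
proof -
  have cross: "A1 * d1 + B1 * c1 = 23/42"
  proof -
    have "A1 * d1 + B1 * c1 = (A1 + B1) * (c1 + d1) - (A1 * c1 + B1 * d1)"
      by (simp add: algebra_simps)
    then show ?thesis unfolding constants_relations by simp
  qed
  have square: "A1 * d1\<^sup>2 + B1 * c1\<^sup>2 = 449/735"
  proof -
    have "A1 * d1\<^sup>2 + B1 * c1\<^sup>2
        = (c1 + d1) * (A1 * d1 + B1 * c1) - (c1 * d1) * (A1 + B1)"
      by (simp add: power2_eq_square algebra_simps)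
    then show ?thesis unfolding constants_relations cross by simp
  qed
  have "A1 * (w - c1) * ((w + d1)\<^sup>2 - w) + B1 * (w - d1) * ((w + c1)\<^sup>2 - w)
      = (A1 + B1) * w ^ 3
        + (2 * (A1 * d1 + B1 * c1) - (A1 + B1) - (A1 * c1 + B1 * d1)) * w\<^sup>2
        + ((A1 * d1\<^sup>2 + B1 * c1\<^sup>2) - 2 * (c1 * d1) * (A1 + B1) + (A1 * c1 + B1 * d1)) * w
        - (c1 * d1) * (A1 * d1 + B1 * c1)"
    by (simp add: power2_eq_square power3_eq_cube algebra_simps)
  note sum = this[unfolded constants_relations cross square]
  show ?thesis
    unfolding quadratic_product sum
    by (simp add: power2_eq_square eval_nat_numeral algebra_simps)
qed

lemma diff_F1:
  assumes "u > 0"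
  shows "F1 u - F1 (u - 1) = - 144 / E u"
proof -
  define w where "w = u\<^sup>2"
  define P where "P = (w + c1)\<^sup>2 - w"
  define Q where "Q = (w + d1)\<^sup>2 - w"
  have pos: "w > 0" "P > 0" "Q > 0"
    using assms quadratic_pair_pos[OF c1_gt, of u] quadratic_pair_pos[OF d1_gt, of u]
    by (simp_all add: w_def P_def Q_def)
  have "Polygamma 1 (u + 1) - Polygamma 1 u = - 1 / w"
    using Polygamma_plus1[of u 1] assms by (simp add: w_def power2_eq_square)
  then have "F1 u - F1 (u - 1)
      = - 1 / w - A1 * (lnq1 c1 u - lnq1 c1 (u - 1)) - B1 * (lnq1 d1 u - lnq1 d1 (u - 1))"
    by (simp add: F1_def algebra_simps)
  also have "\<dots> = - 1 / w + 2 * A1 * (w - c1) / P + 2 * B1 * (w - d1) / Q"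
    unfolding lnq1_diff[OF c1_gt] lnq1_diff[OF d1_gt] w_def[symmetric] P_def[symmetric]
      Q_def[symmetric] using pos by (simp add: field_simps)
  also have "\<dots> = - (P * Q - 2 * w * (A1 * (w - c1) * Q + B1 * (w - d1) * P)) / (w * (P * Q))"
    using pos by (simp add: field_simps)
  also have "\<dots> = - (144 / 1225) / (w * (P * Q))"
    unfolding P_def Q_def numerator_collapses ..
  also have "\<dots> = - 144 / E u"
    unfolding E_factor w_def[symmetric] P_def[symmetric] Q_def[symmetric] by simp
  finally show ?thesis .
qed

section \<open>Convexity of the reciprocal polynomial\<close>

text \<open>
  On the positive half-line the polynomial has its smallest values near \<open>w = 1/5\<close>. The terms of degree
  six and five are therefore split off in multiples of \<open>w ^ 4 * (w - 1/5)\<^sup>2\<close> and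
  \<open>w ^ 3 * (w - 1/5)\<^sup>2\<close>, which costs next to nothing there. The quartic left over is a square that
  accounts for its two lowest coefficients plus \<open>w\<^sup>2\<close> times a quadratic of negative discriminant.
\<close>

lemma convexity_polynomial_pos:
  fixes w :: real
  assumes "w > 0"
  shows "124416 - 1192320 * w + 6685760 * w\<^sup>2 - 25547400 * w ^ 3 + 16540650 * w ^ 4
      + 85851500 * w ^ 5 + 235935000 * w ^ 6 + 223807500 * w ^ 7 + 165068750 * w ^ 8 > 0"
    (is "?R > 0")
proof -
  define q where "q = 3829160 - 32756420 * w + 79193450 * w\<^sup>2"
  have "q = 79193450 * (w - 3275642 / 15838690)\<^sup>2 + (3829160 - 3275642\<^sup>2 * 5 / 15838690)"
    by (simp add: q_def power2_eq_square field_simps)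
  then have q: "q > 0" by (simp add: add_nonneg_pos)
  have "?R = 124416 * (1 - 115/24 * w)\<^sup>2 + w\<^sup>2 * q + 180225500 * (w ^ 3 * (w - 1/5)\<^sup>2)
      + 235935000 * (w ^ 4 * (w - 1/5)\<^sup>2) + 223807500 * w ^ 7 + 165068750 * w ^ 8"
    by (simp add: q_def eval_nat_numeral algebra_simps)
  also have "\<dots> > 0"
    using assms q by (intro add_nonneg_pos add_nonneg_nonneg mult_nonneg_nonneg mult_pos_pos) auto
  finally show ?thesis .
qed

lemma convexity_E:
  assumes "u > 0"
  shows "2 * (E' u)\<^sup>2 - E u * E'' u > 0"
proof -
  define w where "w = u\<^sup>2"
  have "2 * (E' u)\<^sup>2 - E u * E'' u = w * (124416 - 1192320 * w + 6685760 * w\<^sup>2 - 25547400 * w ^ 3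
      + 16540650 * w ^ 4 + 85851500 * w ^ 5 + 235935000 * w ^ 6 + 223807500 * w ^ 7
      + 165068750 * w ^ 8)"
    by (simp add: w_def E_def E'_def E''_def eval_nat_numeral algebra_simps)
  also have "\<dots> > 0"
    using assms convexity_polynomial_pos[of w] by (intro mult_pos_pos) (auto simp: w_def)
  finally show ?thesis .
qed

section \<open>Signs of the derivatives\<close>

text \<open>
  The formula of \<open>diff_F1\<close> holds on an open set, so it may be differentiated, which gives the unit
  differences of the higher derivatives without computing with the logarithms again.
\<close>

lemma diff_F2:
  assumes "u > 0"
  shows "F2 u - F2 (u - 1) = 144 * E' u / (E u)\<^sup>2"
proof (rule DERIV_unique)
  have "((\<lambda>u. F1 u - F1 (u - 1)) has_real_derivative F2 u - F2 (u - 1) * 1) (at u)"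
    using assms
    by (intro DERIV_diff DERIV_chain2[of F1 _ "\<lambda>u. u - 1"] has_derivative_F1)
      (auto intro!: derivative_eq_intros)
  then show "((\<lambda>u. F1 u - F1 (u - 1)) has_real_derivative F2 u - F2 (u - 1)) (at u)" by simp
  have "((\<lambda>u. - 144 / E u) has_real_derivative 144 * E' u / (E u)\<^sup>2) (at u)"
    using E_pos[OF assms]
    by (auto intro!: derivative_eq_intros has_derivative_E simp: power2_eq_square)
  then show "((\<lambda>u. F1 u - F1 (u - 1)) has_real_derivative 144 * E' u / (E u)\<^sup>2) (at u)"
    by (rule has_field_derivative_transform_within_open[of _ _ _ "{0<..}"])
      (use assms diff_F1 in auto)
qed

lemma diff_F3:
  assumes "u > 0"
  shows "F3 u - F3 (u - 1) = - 144 * (2 * (E' u)\<^sup>2 - E u * E'' u) / E u ^ 3"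
proof (rule DERIV_unique)
  have "((\<lambda>u. F2 u - F2 (u - 1)) has_real_derivative F3 u - F3 (u - 1) * 1) (at u)"
    using assms
    by (intro DERIV_diff DERIV_chain2[of F2 _ "\<lambda>u. u - 1"] has_derivative_F2)
      (auto intro!: derivative_eq_intros)
  then show "((\<lambda>u. F2 u - F2 (u - 1)) has_real_derivative F3 u - F3 (u - 1)) (at u)" by simp
  have E0: "E u \<noteq> 0" using E_pos[OF assms] by simp
  have "((\<lambda>u. 144 * E' u / (E u)\<^sup>2) has_real_derivative
      (144 * E'' u * (E u)\<^sup>2 - 144 * E' u * (2 * E u * E' u)) / ((E u)\<^sup>2 * (E u)\<^sup>2)) (at u)"
    using E0 by (auto intro!: derivative_eq_intros has_derivative_E has_derivative_E')
  also have "(144 * E'' u * (E u)\<^sup>2 - 144 * E' u * (2 * E u * E' u)) / ((E u)\<^sup>2 * (E u)\<^sup>2)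
      = - 144 * (2 * (E' u)\<^sup>2 - E u * E'' u) / E u ^ 3"
    using E0 by (simp add: divide_simps power2_eq_square power3_eq_cube) (simp add: algebra_simps)
  finally show "((\<lambda>u. F2 u - F2 (u - 1)) has_real_derivative
      - 144 * (2 * (E' u)\<^sup>2 - E u * E'' u) / E u ^ 3) (at u)"
    by (rule has_field_derivative_transform_within_open[of _ _ _ "{0<..}"])
      (use assms diff_F2 in auto)
qed

lemma F3_pos:
  assumes "x > -1"
  shows "F3 x > 0"
proof (rule pos_if_unit_steps_decrease[OF _ F123_shift_tendsto_0(3)[OF assms]])
  fix y assume "y \<ge> x"
  then have y: "y + 1 > 0" using assms by simp
  have "F3 (y + 1) - F3 y < 0"
    using diff_F3[OF y] convexity_E[OF y] E_pos[OF y] by (simp add: divide_neg_pos)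
  then show "F3 (y + 1) < F3 y" by simp
qed

lemma F2_neg:
  assumes "x > -1"
  shows "F2 x < 0"
proof -
  have "- F2 x > 0"
  proof (rule pos_if_deriv_neg[where G = "\<lambda>y. - F2 y" and G' = "\<lambda>y. - F3 y"])
    show "((\<lambda>y. - F2 y) has_real_derivative - F3 y) (at y)" if "y \<ge> x" for y
      using that assms by (intro DERIV_minus has_derivative_F2) simp
    show "- F3 y < 0" if "y \<ge> x" for y using F3_pos[of y] that assms by simp
    show "(\<lambda>m. - F2 (x + real m)) \<longlonglongrightarrow> 0"
      using tendsto_minus[OF F123_shift_tendsto_0(2)[OF assms]] by simp
  qed
  then show ?thesis by simp
qed

lemma F1_pos:
  assumes "x > -1"
  shows "F1 x > 0"
proof (rule pos_if_deriv_neg[where G = F1 and G' = F2])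
  show "(F1 has_real_derivative F2 y) (at y)" if "y \<ge> x" for y
    using that assms by (intro has_derivative_F1) simp
  show "F2 y < 0" if "y \<ge> x" for y using that assms by (intro F2_neg) simp
  show "(\<lambda>m. F1 (x + real m)) \<longlonglongrightarrow> 0" using F123_shift_tendsto_0(1)[OF assms] .
qed

lemma deriv_eqI_on_greater:
  fixes f f' g :: "real \<Rightarrow> real"
  assumes "\<And>y. y > a \<Longrightarrow> f y = g y" and "\<And>y. y > a \<Longrightarrow> (g has_real_derivative f' y) (at y)"
    and "x > a"
  shows "deriv f x = f' x"
proof (rule DERIV_imp_deriv)
  show "(f has_real_derivative f' x) (at x)"
    by (rule has_field_derivative_transform_within_open[OF assms(2)[OF assms(3)], of "{a<..}"])
      (use assms in auto)
qed

theorem theorem1: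
  fixes x :: real and n :: nat
  assumes "x > -1" and "n \<in> {1, 2, 3}"
  shows "(-1) ^ n * (deriv ^^ n) (F a1) x < 0"
proof -
  have 1: "deriv (F a1) y = F1 y" if "y > -1" for y
    using DERIV_imp_deriv[OF has_derivative_F[OF that]] .
  have 2: "deriv (deriv (F a1)) y = F2 y" if "y > -1" for y
    using deriv_eqI_on_greater[OF 1 has_derivative_F1 that] .
  have 3: "deriv (deriv (deriv (F a1))) y = F3 y" if "y > -1" for y
    using deriv_eqI_on_greater[OF 2 has_derivative_F2 that] .
  from assms(2) consider "n = 1" | "n = 2" | "n = 3" by auto
  then show ?thesis
    using assms(1) 1 2 3 F1_pos F2_neg F3_pos
    by cases (simp_all add: numeral_2_eq_2 numeral_3_eq_3)
qed

end
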